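(* Let $(\mathcal{P},\mathcal{H})$ be an intersection-closed hypothesis space. An E-capacity kernel $\varepsilon$ for $\mathcal{H}$ is valid if and only if it controls the false evidence rate uniformly across selection rules, i.e. if and only if for every selection rule $S$, $$\sup_{P\in\mathcal{P}}\mathbb{E}^P\left[\mathrm{FEP}^S_P(X)\right]\le1.$$
   Context: $(\mathcal{X},\Sigma)$ is a measurable space and $\mathcal{P}$ a collection of probability measures on it; $\mathbb{E}^P$ is expectation when $X\in\mathcal{X}$ has law $P$. A hypothesis class $\mathcal{H}$ is a collection of subsets of $\mathcal{P}$ closed under arbitrary unions (including the empty union, so $\emptyset\in\mathcal{H}$); $(\mathcal{P},\mathcal{H})$ is then a hypothesis space. It is intersection-closed if $\mathcal{H}$ is also closed under arbitrary intersections and $\mathcal{P}\in\mathcal{H}$. An E-capacity is a map $\varepsilon:\mathcal{H}\to[0,\infty]$ with $\varepsilon(\emptyset)=\infty$ and $\varepsilon(H')\le\varepsilon(H)$ whenever $H\subseteq H'$, $H,H'\in\mathcal{H}$. An E-capacity kernel is a map $\varepsilon:\mathcal{H}\times\mathcal{X}\to[0,\infty]$, written $\varepsilon(H\mid x)$, with $x\mapsto\varepsilon(H\mid x)$ $\Sigma$-measurable for every $H\in\mathcal{H}$ and $H\mapsto\varepsilon(H\mid x)$ an E-capacity for every $x\in\mathcal{X}$. It is valid if $\mathbb{E}^P[\varepsilon(H\mid X)]\le1$ for every nonempty $H\in\mathcal{H}$ and every $P\in H$. A selection rule is a map $S:\mathcal{X}\to2^{\mathcal{H}}$ such that $S(x)$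 is finite for every $x\in\mathcal{X}$ and $x\mapsto\mathbf{1}\{H\in S(x)\}$ is $\Sigma$-measurable for every $H\in\mathcal{H}$. The false evidence proportion at $P$ with respect to $S$ is $$\mathrm{FEP}^S_P(x)=\frac{1}{|S(x)|\vee1}\sum_{H\in S(x):H\ni P}\varepsilon(H\mid x).$$ *)

theory Defs
  imports "HOL-Probability.Probability_Measure"
begin

text \<open>
  A measurable space is represented by a measure \<open>M\<close>, of which only \<open>space M\<close> and
  \<open>sets M\<close> are used.  Hypotheses are sets of probability measures on it.
\<close>

definition prob_measures_on :: "'a measure \<Rightarrow> 'a measure set \<Rightarrow> bool" where
  "prob_measures_on M \<P> \<longleftrightarrow> (\<forall>P\<in>\<P>. prob_space P \<and> sets P = sets M)"

text \<open>The family \<open>A = {}\<close> is allowed below, so \<open>{} \<in> \<H>\<close>.\<close>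

definition hypothesis_space :: "'a measure \<Rightarrow> 'a measure set \<Rightarrow> 'a measure set set \<Rightarrow> bool" where
  "hypothesis_space M \<P> \<H> \<longleftrightarrow>
     prob_measures_on M \<P> \<and> \<H> \<subseteq> Pow \<P> \<and> (\<forall>A. A \<subseteq> \<H> \<longrightarrow> \<Union>A \<in> \<H>)"

text \<open>
  The empty intersection, taken relative to \<open>\<P>\<close>, is \<open>\<P>\<close> itself and not the
  library value \<open>\<Inter>{} = UNIV\<close>; it is covered by the clause \<open>\<P> \<in> \<H>\<close>.
\<close>

definition intersection_closed :: "'a measure set \<Rightarrow> 'a measure set set \<Rightarrow> bool" where
  "intersection_closed \<P> \<H> \<longleftrightarrow>
     \<P> \<in> \<H> \<and> (\<forall>A. A \<subseteq> \<H> \<longrightarrow> A \<noteq> {} \<longrightarrow> \<Inter>A \<in> \<H>)"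

definition e_capacity :: "'a measure set set \<Rightarrow> ('a measure set \<Rightarrow> ennreal) \<Rightarrow> bool" where
  "e_capacity \<H> \<epsilon> \<longleftrightarrow>
     \<epsilon> {} = \<infinity> \<and> (\<forall>H\<in>\<H>. \<forall>H'\<in>\<H>. H \<subseteq> H' \<longrightarrow> \<epsilon> H' \<le> \<epsilon> H)"

definition e_capacity_kernel ::
    "'a measure \<Rightarrow> 'a measure set set \<Rightarrow> ('a measure set \<Rightarrow> 'a \<Rightarrow> ennreal) \<Rightarrow> bool" where
  "e_capacity_kernel M \<H> \<epsilon> \<longleftrightarrow>
     (\<forall>H\<in>\<H>. \<epsilon> H \<in> borel_measurable M) \<and>
     (\<forall>x\<in>space M. e_capacity \<H> (\<lambda>H. \<epsilon> H x))"

definition valid_kernel ::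
    "'a measure set set \<Rightarrow> ('a measure set \<Rightarrow> 'a \<Rightarrow> ennreal) \<Rightarrow> bool" where
  "valid_kernel \<H> \<epsilon> \<longleftrightarrow>
     (\<forall>H\<in>\<H>. H \<noteq> {} \<longrightarrow> (\<forall>P\<in>H. (\<integral>\<^sup>+x. \<epsilon> H x \<partial>P) \<le> 1))"

definition selection_rule ::
    "'a measure \<Rightarrow> 'a measure set set \<Rightarrow> ('a \<Rightarrow> 'a measure set set) \<Rightarrow> bool" where
  "selection_rule M \<H> S \<longleftrightarrow>
     (\<forall>x\<in>space M. S x \<subseteq> \<H> \<and> finite (S x)) \<and>
     (\<forall>H\<in>\<H>. (\<lambda>x. indicator (S x) H :: real) \<in> borel_measurable M)"

definition FEP ::
    "('a measure set \<Rightarrow> 'a \<Rightarrow> ennreal) \<Rightarrow> ('a \<Rightarrow> 'a measure set set) \<Rightarrow> 'a measure \<Rightarrow> 'a \<Rightarrow> ennreal"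
  where
  "FEP \<epsilon> S P x = 1 / of_nat (max (card (S x)) 1) * (\<Sum>H\<in>{H \<in> S x. P \<in> H}. \<epsilon> H x)"

text \<open>
  If \<open>\<H>\<close> is uncountable, a selection rule need not make \<open>FEP \<epsilon> S P\<close> measurable;
  the integral below is then the lower integral, by the definition of
  \<^const>\<open>nn_integral\<close>.
\<close>

definition false_evidence_rate ::
    "('a measure set \<Rightarrow> 'a \<Rightarrow> ennreal) \<Rightarrow> ('a \<Rightarrow> 'a measure set set) \<Rightarrow> 'a measure \<Rightarrow> ennreal"
  where
  "false_evidence_rate \<epsilon> S P = (\<integral>\<^sup>+x. FEP \<epsilon> S P x \<partial>P)"

end

theory Submission
  imports Defs
begin

text \<open>
  If \<open>\<H>\<close> is intersection-closed, there is a least hypothesis containing \<open>P\<close>.  By monotonicity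
  its evidence dominates that of every true hypothesis, hence also the average \<open>FEP \<epsilon> S P\<close>,
  whatever \<open>S\<close> is.  Conversely, validity at \<open>H\<close> is error control for the constant rule \<open>{H}\<close>.
\<close>

text \<open>The witness is the intersection of all hypotheses containing \<open>P\<close>. This
  family contains \<P>, hence is nonempty, so closure under nonempty intersections applies.\<close>

lemma intersection_closed_least:
  assumes "\<H> \<subseteq> Pow \<P>" "intersection_closed \<P> \<H>" "P \<in> \<P>"
  obtains K where "K \<in> \<H>" "P \<in> K" "\<And>H. H \<in> \<H> \<Longrightarrow> P \<in> H \<Longrightarrow> K \<subseteq> H"
proof
  let ?A = "{H \<in> \<H>. P \<in> H}"
  have "\<P> \<in> ?A" "?A \<subseteq> \<H>"
    using assms by (auto simp: intersection_closed_def)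
  then show "\<Inter>?A \<in> \<H>"
    using assms(2) by (metis empty_iff intersection_closed_def)
qed auto

text \<open>The sum has at most \<open>card (S x)\<close> terms, each at most \<open>c\<close>, and
  the divisor is no smaller than that number. The value \<open>c\<close> = \<infinity> is
  allowed.\<close>

lemma FEP_le:
  assumes "finite (S x)" "\<And>H. H \<in> S x \<Longrightarrow> P \<in> H \<Longrightarrow> \<epsilon> H x \<le> c"
  shows "FEP \<epsilon> S P x \<le> c"
proof -
  let ?n = "max (card (S x)) 1"
  have "(\<Sum>H\<in>{H \<in> S x. P \<in> H}. \<epsilon> H x) \<le> of_nat (card {H \<in> S x. P \<in> H}) * c"
    using assms(2) by (intro sum_bounded_above) auto
  also have "\<dots> \<le> of_nat ?n * c"
    using card_mono[of "S x" "{H \<in> S x. P \<in> H}"] assms(1)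
    by (intro mult_right_mono) (auto intro!: max.coboundedI1)
  finally have "FEP \<epsilon> S P x \<le> 1 / of_nat ?n * (of_nat ?n * c)"
    unfolding FEP_def by (intro mult_left_mono) auto
  also have "\<dots> = (of_nat ?n / of_nat ?n) * c"
    by (simp add: divide_ennreal_def mult_ac)
  \<comment> \<open>Cancellation in \<open>ennreal\<close> needs a divisor other than 0 and
    \<infinity>; the maximum with 1 keeps it nonzero even when \<open>S x\<close> is empty.\<close>
  also have "(of_nat ?n / of_nat ?n :: ennreal) = 1"
    by (intro ennreal_divide_self) (auto simp: max_def of_nat_less_top)
  finally show ?thesis by simp
qed

lemma FEP_singleton: "P \<in> H \<Longrightarrow> FEP \<epsilon> (\<lambda>_. {H}) P x = \<epsilon> H x"
proof -
  assume "P \<in> H"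
  then have "{H' \<in> {H}. P \<in> H'} = {H}" by auto
  then show ?thesis by (simp add: FEP_def)
qed

lemma selection_rule_const:
  "A \<subseteq> \<H> \<Longrightarrow> finite A \<Longrightarrow> selection_rule M \<H> (\<lambda>_. A)"
  by (simp add: selection_rule_def)

theorem corollary6:
  fixes M :: "'a measure"
    and \<P> :: "'a measure set"
    and \<H> :: "'a measure set set"
    and \<epsilon> :: "'a measure set \<Rightarrow> 'a \<Rightarrow> ennreal"
  assumes "hypothesis_space M \<P> \<H>"
    and "intersection_closed \<P> \<H>"
    and "e_capacity_kernel M \<H> \<epsilon>"
  shows "valid_kernel \<H> \<epsilon> \<longleftrightarrow>
    (\<forall>S. selection_rule M \<H> S \<longrightarrow> (SUP P\<in>\<P>. false_evidence_rate \<epsilon> S P) \<le> 1)"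
proof (intro iffI allI impI SUP_least)
  fix S P
  assume valid: "valid_kernel \<H> \<epsilon>" and S: "selection_rule M \<H> S" and P: "P \<in> \<P>"
  obtain K where K: "K \<in> \<H>" "P \<in> K" "\<And>H. H \<in> \<H> \<Longrightarrow> P \<in> H \<Longrightarrow> K \<subseteq> H"
    using intersection_closed_least[of \<H> \<P> P] assms(1,2) P
    unfolding hypothesis_space_def by metis
  \<comment> \<open>The integral ranges over \<open>space P\<close>, whereas \<open>S\<close> and
    \<epsilon> are controlled pointwise on \<open>space M\<close>.\<close>
  have "space P = space M"
    using assms(1) P
    by (intro sets_eq_imp_space_eq) (auto simp: hypothesis_space_def prob_measures_on_def)
  moreover have "FEP \<epsilon> S P x \<le> \<epsilon> K x" if "x \<in> space M" for x
  proof (rule FEP_le)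
    show "finite (S x)"
      using S that by (simp add: selection_rule_def)
    fix H assume H: "H \<in> S x" "P \<in> H"
    with S that have "H \<in> \<H>"
      by (auto simp: selection_rule_def)
    with K H assms(3) that show "\<epsilon> H x \<le> \<epsilon> K x"
      by (simp add: e_capacity_kernel_def e_capacity_def)
  qed
  \<comment> \<open>Lower integrals are monotone too, so a non-measurable \<open>FEP\<close> is
    covered.\<close>
  ultimately have "false_evidence_rate \<epsilon> S P \<le> (\<integral>\<^sup>+x. \<epsilon> K x \<partial>P)"
    unfolding false_evidence_rate_def by (intro nn_integral_mono) simp
  also have "\<dots> \<le> 1"
    using valid K(1,2) by (auto simp: valid_kernel_def)
  finally show "false_evidence_rate \<epsilon> S P \<le> 1" .
next
  assume control:
    "\<forall>S. selection_rule M \<H> S \<longrightarrow> (SUP P\<in>\<P>. false_evidence_rate \<epsilon> S P) \<le> 1"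
  show "valid_kernel \<H> \<epsilon>"
    unfolding valid_kernel_def
  proof (intro ballI impI)
    fix H P assume H: "H \<in> \<H>" "P \<in> H"
    then have "P \<in> \<P>"
      using assms(1) by (auto simp: hypothesis_space_def)
    \<comment> \<open>This rule ignores the data, so its indicators are constant and measurable; its
      divisor is 1, so averaging leaves the evidence against \<open>H\<close> unchanged.\<close>
    moreover have "(SUP P\<in>\<P>. false_evidence_rate \<epsilon> (\<lambda>_. {H}) P) \<le> 1"
      using control H(1) selection_rule_const[of "{H}"] by simp
    ultimately have "false_evidence_rate \<epsilon> (\<lambda>_. {H}) P \<le> 1"
      by (simp add: SUP_le_iff)
    then show "(\<integral>\<^sup>+x. \<epsilon> H x \<partial>P) \<le> 1"
      using H(2) by (simp add: false_evidence_rate_def FEP_singleton)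
  qed
qed

end
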